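(* Let $G$ be a finite simple undirected graph with vertex set $V$, $|V|=n$, edge set $E$, $|E|=m\ge 1$, and vertex degrees $d_i$ ($i\in V$), and let $\mu$ be the largest eigenvalue of its adjacency matrix. Put $$\beta=\frac{\mu n}{2m},\qquad \epsilon=\frac{n\sum_{ij\in E}\sqrt{d_id_j}}{2m^2},\qquad R(G)=\sum_{ij\in E}\frac{1}{\sqrt{d_id_j}}.$$ Then $$\frac{m}{\mu}=\frac{n}{2\beta}\le\frac{n}{2\epsilon}\le R(G).$$
   Context: $R(G)$ is the Randić index of $G$. Sums over $ij\in E$ run over each (unordered) edge once. The quantities $\beta$ and $\epsilon$ are measures of irregularity of $G$, defined for graphs with at least one edge. *)

theory Defs
  imports "HOL-Analysis.Analysis" "Graph_Theory.Pair_Digraph" "Jordan_Normal_Form.Spectral_Radius"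
begin

text \<open>
  A finite simple undirected graph is a \<open>pair_graph\<close>: a finite, loop-free digraph with a
  symmetric arc relation and no parallel arcs. Each undirected edge \<open>ij\<close> is therefore represented
  by the two arcs \<open>(i, j)\<close> and \<open>(j, i)\<close>; \<open>edges\<close> identifies these, so that its cardinality
  is the number of undirected edges and sums over it visit each edge once.
\<close>

definition edges :: "'a pair_pre_digraph \<Rightarrow> 'a set set" where
  "edges G = {{i, j} | i j. (i, j) \<in> parcs G}"

text \<open>By symmetry of the arc relation, in-degree and out-degree are both the number of neighbours.\<close>

definition vertex_degree :: "'a pair_pre_digraph \<Rightarrow> 'a \<Rightarrow> nat" where
  "vertex_degree G i = out_degree (with_proj G) i"

text \<open>
  The rows and columns are indexed by positions in a list \<open>vs\<close> enumerating the vertices; another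
  enumeration gives a permutation-similar matrix.
\<close>

definition adjacency_matrix :: "'a pair_pre_digraph \<Rightarrow> 'a list \<Rightarrow> real mat" where
  "adjacency_matrix G vs =
     mat (length vs) (length vs) (\<lambda>(k, l). if (vs ! k, vs ! l) \<in> parcs G then 1 else 0)"

text \<open>
  For a nonempty real symmetric matrix the set of (real) eigenvalues is finite and nonempty, so the
  maximum is attained; for other matrices \<open>Max\<close> may be unspecified.
\<close>

definition largest_eigenvalue :: "real mat \<Rightarrow> real" where
  "largest_eigenvalue A = Max (spectrum A)"

text \<open>For an edge \<open>e = {i, j}\<close> we have \<open>i \<noteq> j\<close>, so the product over \<open>e\<close> below is \<open>d\<^sub>i d\<^sub>j\<close>.\<close>

definition randic_index :: "'a pair_pre_digraph \<Rightarrow> real" where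
  "randic_index G = (\<Sum>e\<in>edges G. 1 / sqrt (\<Prod>i\<in>e. real (vertex_degree G i)))"

definition beta_irregularity :: "'a pair_pre_digraph \<Rightarrow> 'a list \<Rightarrow> real" where
  "beta_irregularity G vs =
     largest_eigenvalue (adjacency_matrix G vs) * real (card (pverts G)) /
       (2 * real (card (edges G)))"

definition epsilon_irregularity :: "'a pair_pre_digraph \<Rightarrow> real" where
  "epsilon_irregularity G =
     real (card (pverts G)) * (\<Sum>e\<in>edges G. sqrt (\<Prod>i\<in>e. real (vertex_degree G i))) /
       (2 * (real (card (edges G)))\<^sup>2)"

end

(* With S the sum of sqrt (d_i d_j) over the edges, testing the Rayleigh quotient of the
   adjacency matrix on the vector x_i = sqrt d_i gives 2 S / (2 m) <= mu, the middle inequality.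
   The last one, m^2 <= S * R(G), is Cauchy-Schwarz. The Rayleigh bound comes from maximising the
   quadratic form over the unit sphere: a maximiser is an eigenvector, by a first-order
   perturbation. *)

theory Submission
  imports Defs
begin

section \<open>Quadratic forms and the largest eigenvalue\<close>

text \<open>Let \<open>g\<close> be the image of \<open>x\<close> under \<open>b\<close>. If
  \<open>g\<close> were nonzero, then moving from \<open>x\<close> along \<open>g\<close> would
  raise the form from 0 at first order with slope twice the squared norm of \<open>g\<close>, so it
  would be positive for a small step. This is the first-order optimality condition at a
  maximiser.\<close>

lemma negative_semidefinite_isotropic_in_kernel:
  fixes b :: "'i \<Rightarrow> 'i \<Rightarrow> real"
  assumes fin: "finite I"
    and sym: "\<And>i j. i \<in> I \<Longrightarrow> j \<in> I \<Longrightarrow> b i j = b j i"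
    and neg: "\<And>y. (\<Sum>i\<in>I. \<Sum>j\<in>I. b i j * y i * y j) \<le> 0"
    and zero: "(\<Sum>i\<in>I. \<Sum>j\<in>I. b i j * x i * x j) = 0"
    and i: "i \<in> I"
  shows "(\<Sum>j\<in>I. b i j * x j) = 0"
proof (rule ccontr)
  assume nz: "\<not> ?thesis"
  define Q where "Q y = (\<Sum>i\<in>I. \<Sum>j\<in>I. b i j * y i * y j)" for y
  define g where "g i = (\<Sum>j\<in>I. b i j * x j)" for i
  define s where "s = (\<Sum>i\<in>I. (g i)\<^sup>2)"
  have spos: "s > 0"
    unfolding s_def using fin i nz by (intro sum_pos2[of I i]) (auto simp: g_def)
  have gx: "(\<Sum>i\<in>I. \<Sum>j\<in>I. b i j * g i * x j) = s"
    unfolding s_def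
    by (intro sum.cong refl) (simp add: g_def power2_eq_square sum_distrib_left mult_ac)
  \<comment> \<open>By symmetry of \<open>b\<close> the second cross term equals the first, so
    together they contribute \<open>2 * t * s\<close>.\<close>
  have "(\<Sum>i\<in>I. \<Sum>j\<in>I. b i j * x i * g j) = (\<Sum>i\<in>I. \<Sum>j\<in>I. b j i * x j * g i)"
    by (rule sum.swap)
  also have "\<dots> = (\<Sum>i\<in>I. \<Sum>j\<in>I. b i j * g i * x j)"
    by (intro sum.cong refl) (use sym in \<open>simp add: mult_ac\<close>)
  finally have xg: "(\<Sum>i\<in>I. \<Sum>j\<in>I. b i j * x i * g j) = s"
    using gx by simp
  have expand: "Q (\<lambda>i. x i + t * g i) = 2 * t * s + t\<^sup>2 * Q g" for t
  proof -
    have "Q (\<lambda>i. x i + t * g i) =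
        (\<Sum>i\<in>I. \<Sum>j\<in>I. b i j * x i * x j + t * (b i j * x i * g j) +
          t * (b i j * g i * x j) + t\<^sup>2 * (b i j * g i * g j))"
      unfolding Q_def by (intro sum.cong refl) (simp add: algebra_simps power2_eq_square)
    also have "\<dots> = Q x + t * s + t * s + t\<^sup>2 * Q g"
      by (simp add: sum.distrib sum_distrib_left[symmetric] xg gx Q_def)
    finally show ?thesis using zero by (simp add: Q_def)
  qed
  \<comment> \<open>\<open>t\<close> is small enough for the first-order term \<open>2 t s\<close> to dominate \<open>t\<^sup>2 Q g\<close>.\<close>
  define t where "t = s / (\<bar>Q g\<bar> + 1)"
  have t: "t > 0" using spos by (simp add: t_def)
  have "t * \<bar>Q g\<bar> < s"
    using spos by (simp add: t_def field_simps)
  hence "- (t * Q g) < s" using t by (smt (verit) mult_minus_right mult_left_mono)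
  hence "0 < 2 * s + t * Q g" using spos by linarith
  hence "0 < t * (2 * s + t * Q g)" using t by simp
  also have "\<dots> = Q (\<lambda>i. x i + t * g i)"
    by (simp add: expand algebra_simps power2_eq_square)
  finally show False using neg[of "\<lambda>i. x i + t * g i"] by (simp add: Q_def)
qed

text \<open>Vectors are functions on the whole index type, so coordinates outside \<open>I\<close>
  are pinned to 0; otherwise they would be unconstrained. The set is then closed in a product of
  compact sets, which is compact by Tychonoff.\<close>

lemma compact_unit_sphere_finite_support:
  assumes fin: "finite I"
  shows "compact {x :: 'i \<Rightarrow> real. (\<forall>i. i \<notin> I \<longrightarrow> x i = 0) \<and> (\<Sum>i\<in>I. (x i)\<^sup>2) = 1}"
proof -
  let ?K = "PiE UNIV (\<lambda>i. if i \<in> I then {-1..1::real} else {0})"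
  let ?C = "{x :: 'i \<Rightarrow> real. (\<Sum>i\<in>I. (x i)\<^sup>2) = 1}"
  have "compactin (product_topology (\<lambda>_. euclidean) UNIV) ?K"
    unfolding compactin_PiE by auto
  hence K: "compact ?K"
    by (simp add: euclidean_product_topology)
  have "continuous_on UNIV (\<lambda>x :: 'i \<Rightarrow> real. \<Sum>i\<in>I. (x i)\<^sup>2)"
    by (intro continuous_intros continuous_on_product_coordinates)
  hence C: "closed ?C"
    by (intro closed_Collect_eq) auto
  have bound: "- 1 \<le> x i \<and> x i \<le> 1" if "(\<Sum>i\<in>I. (x i)\<^sup>2) = 1" "i \<in> I" for x :: "'i \<Rightarrow> real" and i
  proof -
    have "(x i)\<^sup>2 \<le> (\<Sum>i\<in>I. (x i)\<^sup>2)"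
      using fin that(2) by (intro member_le_sum) auto
    hence "\<bar>x i\<bar> \<le> 1" using that(1) by (simp add: abs_square_le_1)
    thus ?thesis by linarith
  qed
  have "{x :: 'i \<Rightarrow> real. (\<forall>i. i \<notin> I \<longrightarrow> x i = 0) \<and> (\<Sum>i\<in>I. (x i)\<^sup>2) = 1} = ?K \<inter> ?C"
    using bound by (auto simp: PiE_iff split: if_splits)
  thus ?thesis using compact_Int_closed[OF K C] by simp
qed

text \<open>\<open>M\<close> is the maximum of the form on the unit sphere and \<open>x\<close> a
  point attaining it. The form of \<open>a\<close> minus \<open>M\<close> times the identity is then
  nonpositive everywhere and vanishes at \<open>x\<close>, so \<open>x\<close> lies in the kernel of
  that matrix.\<close>

lemma symmetric_kernel_max_eigenpair:
  fixes a :: "'i \<Rightarrow> 'i \<Rightarrow> real"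
  assumes fin: "finite I" and ne: "I \<noteq> {}"
    and sym: "\<And>i j. i \<in> I \<Longrightarrow> j \<in> I \<Longrightarrow> a i j = a j i"
  obtains M x where
    "\<And>i. i \<in> I \<Longrightarrow> (\<Sum>j\<in>I. a i j * x j) = M * x i"
    "(\<Sum>i\<in>I. (x i)\<^sup>2) = 1"
    "\<And>y. (\<Sum>i\<in>I. \<Sum>j\<in>I. a i j * y i * y j) \<le> M * (\<Sum>i\<in>I. (y i)\<^sup>2)"
proof -
  define Q where "Q y = (\<Sum>i\<in>I. \<Sum>j\<in>I. a i j * y i * y j)" for y
  let ?S = "{x :: 'i \<Rightarrow> real. (\<forall>i. i \<notin> I \<longrightarrow> x i = 0) \<and> (\<Sum>i\<in>I. (x i)\<^sup>2) = 1}"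
  obtain k where k: "k \<in> I" using ne by auto
  \<comment> \<open>A standard basis vector shows that the sphere is nonempty.\<close>
  have "(\<Sum>i\<in>I. (if i = k then 1 else 0 :: real)\<^sup>2) = (\<Sum>i\<in>I. if i = k then 1 else 0)"
    by (intro sum.cong) auto
  also have "\<dots> = 1" using fin k by simp
  finally have "(\<lambda>i. if i = k then 1 else 0) \<in> ?S" using k by auto
  hence "?S \<noteq> {}" by (metis empty_iff)
  moreover have "continuous_on UNIV Q"
    unfolding Q_def by (intro continuous_intros continuous_on_product_coordinates)
  hence "continuous_on ?S Q" by (rule continuous_on_subset) simp
  ultimately have "\<exists>x\<in>?S. \<forall>y\<in>?S. Q y \<le> Q x"
    by (rule continuous_attains_sup[OF compact_unit_sphere_finite_support[OF fin]])
  then obtain x where x: "x \<in> ?S" and max: "\<forall>y\<in>?S. Q y \<le> Q x"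
    by (rule bexE)
  define M where "M = Q x"
  \<comment> \<open>The bound on the sphere extends to all \<open>y\<close> because both sides are
    homogeneous of degree 2. The normalised vector \<open>z\<close> is also cut off outside
    \<open>I\<close>, since \<open>y\<close> need not vanish there.\<close>
  have bound: "Q y \<le> M * (\<Sum>i\<in>I. (y i)\<^sup>2)" for y
  proof (cases "(\<Sum>i\<in>I. (y i)\<^sup>2) = 0")
    case True
    hence "\<forall>i\<in>I. y i = 0" using fin by (simp add: sum_nonneg_eq_0_iff)
    thus ?thesis by (simp add: Q_def)
  next
    case False
    define r where "r = sqrt (\<Sum>i\<in>I. (y i)\<^sup>2)"
    have r2: "r\<^sup>2 = (\<Sum>i\<in>I. (y i)\<^sup>2)" by (simp add: r_def sum_nonneg)
    have r: "r\<^sup>2 > 0" using False r2 by (metis zero_less_power2 zero_power2)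
    define z where "z i = (if i \<in> I then y i / r else 0)" for i
    have "(\<Sum>i\<in>I. (z i)\<^sup>2) = (\<Sum>i\<in>I. (y i)\<^sup>2) / r\<^sup>2"
      by (simp add: z_def power_divide sum_divide_distrib)
    hence "z \<in> ?S" using r r2 by (simp add: z_def)
    hence "Q z \<le> M" unfolding M_def by (rule max[rule_format])
    moreover have "Q z = Q y / r\<^sup>2"
      by (simp add: Q_def z_def sum_divide_distrib power2_eq_square)
    ultimately show ?thesis using r by (simp only: r2[symmetric]) (simp add: pos_divide_le_eq)
  qed
  \<comment> \<open>Subtracting \<open>M\<close> on the diagonal turns the eigenvalue equation into
    a kernel condition.\<close>
  define b where "b i j = a i j - (if i = j then M else 0)" for i j
  have b_row: "(\<Sum>j\<in>I. b i j * y j) = (\<Sum>j\<in>I. a i j * y j) - M * y i" if "i \<in> I" for i y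
    using fin that
    by (simp add: b_def left_diff_distrib sum_subtractf if_distrib[of "\<lambda>c. c * _"] cong: if_cong)
  have b_form: "(\<Sum>i\<in>I. \<Sum>j\<in>I. b i j * y i * y j) = Q y - M * (\<Sum>i\<in>I. (y i)\<^sup>2)" for y
  proof -
    have "(\<Sum>i\<in>I. \<Sum>j\<in>I. b i j * y i * y j) = (\<Sum>i\<in>I. y i * (\<Sum>j\<in>I. b i j * y j))"
      by (simp add: sum_distrib_left mult_ac)
    also have "\<dots> = (\<Sum>i\<in>I. y i * ((\<Sum>j\<in>I. a i j * y j) - M * y i))"
      by (intro sum.cong refl) (simp add: b_row)
    also have "\<dots> = Q y - M * (\<Sum>i\<in>I. (y i)\<^sup>2)"
      by (simp add: Q_def right_diff_distrib sum_subtractf sum_distrib_left power2_eq_square mult_ac)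
    finally show ?thesis .
  qed
  have "(\<Sum>j\<in>I. b i j * x j) = 0" if "i \<in> I" for i
  proof (rule negative_semidefinite_isotropic_in_kernel[OF fin _ _ _ that])
    show "b i j = b j i" if "i \<in> I" "j \<in> I" for i j
      using sym[OF that] by (simp add: b_def)
    show "(\<Sum>i\<in>I. \<Sum>j\<in>I. b i j * y i * y j) \<le> 0" for y
      using bound[of y] by (simp add: b_form)
    show "(\<Sum>i\<in>I. \<Sum>j\<in>I. b i j * x i * x j) = 0"
      using x by (simp add: b_form M_def)
  qed
  hence eig: "(\<Sum>j\<in>I. a i j * x j) = M * x i" if "i \<in> I" for i
    using b_row[OF that, of x] that by simp
  show ?thesis
  proof (rule that[of x M])
    show "(\<Sum>i\<in>I. (x i)\<^sup>2) = 1" using x by simp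
    show "(\<Sum>i\<in>I. \<Sum>j\<in>I. a i j * y i * y j) \<le> M * (\<Sum>i\<in>I. (y i)\<^sup>2)" for y
      using bound[of y] by (simp only: Q_def)
  qed (rule eig)
qed

text \<open>The form is bounded by some eigenvalue \<open>M\<close> times the squared norm, and
  \<open>M\<close> is at most the maximum of the finite spectrum.\<close>

lemma rayleigh_le_largest_eigenvalue:
  fixes A :: "real mat"
  assumes A: "A \<in> carrier_mat n n"
    and sym: "\<And>i j. i < n \<Longrightarrow> j < n \<Longrightarrow> A $$ (i, j) = A $$ (j, i)"
  shows "(\<Sum>i<n. \<Sum>j<n. A $$ (i, j) * y i * y j) \<le> largest_eigenvalue A * (\<Sum>i<n. (y i)\<^sup>2)"
\<comment> \<open>For \<open>n = 0\<close> the spectrum is empty and its \<open>Max\<close>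
  unspecified, but both sides are 0.\<close>
proof (cases "n = 0")
  case False
  hence ne: "{..<n} \<noteq> {}" by auto
  have sym': "A $$ (i, j) = A $$ (j, i)" if "i \<in> {..<n}" "j \<in> {..<n}" for i j
    using sym that by simp
  obtain M x where eig: "\<And>i. i < n \<Longrightarrow> (\<Sum>j<n. A $$ (i, j) * x j) = M * x i"
    and unit: "(\<Sum>i<n. (x i)\<^sup>2) = 1"
    and bound: "\<And>y. (\<Sum>i<n. \<Sum>j<n. A $$ (i, j) * y i * y j) \<le> M * (\<Sum>i<n. (y i)\<^sup>2)"
    by (rule symmetric_kernel_max_eigenpair[where a = "\<lambda>i j. A $$ (i, j)",
          OF finite_lessThan ne sym', unfolded lessThan_iff]) blast+
  have nz: "vec n x \<noteq> 0\<^sub>v n"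
  proof
    assume "vec n x = 0\<^sub>v n"
    hence "x i = 0" if "i < n" for i using that by (metis index_vec index_zero_vec(1))
    thus False using unit by simp
  qed
  have "A *\<^sub>v vec n x = M \<cdot>\<^sub>v vec n x"
    using A eig by (intro eq_vecI) (auto simp: scalar_prod_def lessThan_atLeast0)
  hence "eigenvector A (vec n x) M"
    using A nz by (auto simp: eigenvector_def)
  hence "M \<in> spectrum A" by (auto simp: spectrum_def eigenvalue_def)
  hence "M \<le> largest_eigenvalue A"
    unfolding largest_eigenvalue_def using card_finite_spectrum(1)[OF A] by simp
  hence "M * (\<Sum>i<n. (y i)\<^sup>2) \<le> largest_eigenvalue A * (\<Sum>i<n. (y i)\<^sup>2)"
    by (intro mult_right_mono sum_nonneg) auto
  thus ?thesis using bound[of y] by linarith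
qed simp

section \<open>Degrees, arcs and edges\<close>

lemma sum_vertex_degree:
  assumes "pair_fin_digraph G"
  shows "(\<Sum>i\<in>pverts G. vertex_degree G i) = card (parcs G)"
proof -
  interpret pair_fin_digraph G by fact
  have "card (parcs G) = (\<Sum>i\<in>pverts G. card {e \<in> parcs G. fst e = i})"
    using sum.group[of "parcs G" "pverts G" fst "\<lambda>_. 1::nat"]
      pair_finite_verts pair_finite_arcs arc_fst_in_verts
    by (auto simp: image_subset_iff)
  thus ?thesis
    by (simp add: vertex_degree_def out_degree_def out_arcs_def)
qed

lemma vertex_degree_pos:
  assumes "pair_fin_digraph G" "(i, j) \<in> parcs G"
  shows "vertex_degree G i > 0"
proof -
  interpret pair_fin_digraph G by fact
  have "(i, j) \<in> {e \<in> parcs G. fst e = i}" using assms(2) by simp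
  thus ?thesis
    using pair_finite_arcs by (auto simp: vertex_degree_def out_degree_def out_arcs_def card_gt_0_iff)
qed

lemma parcs_swap:
  assumes "pair_graph G" "(i, j) \<in> parcs G"
  shows "(j, i) \<in> parcs G"
proof -
  interpret pair_graph G by fact
  show ?thesis using pair_sym_arcs assms(2) by (auto simp: symmetric_def sym_def)
qed

text \<open>Each edge comes from exactly two arcs, which are distinct because there are no loops.
  This links the matrix form, a sum over arcs, to sums over edges.\<close>

lemma sum_parcs_eq_twice_sum_edges:
  fixes f :: "'a set \<Rightarrow> 'b::comm_semiring_1"
  assumes "pair_graph G"
  shows "(\<Sum>(i, j)\<in>parcs G. f {i, j}) = 2 * (\<Sum>e\<in>edges G. f e)"
proof -
  interpret pair_graph G by fact
  let ?p = "\<lambda>(i, j). {i, j}"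
  have edges: "edges G = ?p ` parcs G"
    by (force simp: edges_def)
  have "(\<Sum>a\<in>{a \<in> parcs G. ?p a = e}. f (?p a)) = 2 * f e" if e: "e \<in> edges G" for e
  proof -
    obtain i j where ij: "(i, j) \<in> parcs G" "e = {i, j}"
      using e by (auto simp: edges_def)
    have "i \<noteq> j" using pair_no_loops[OF ij(1)] by simp
    moreover have "{a \<in> parcs G. ?p a = e} = {(i, j), (j, i)}"
      using ij parcs_swap[OF assms] by (auto simp: doubleton_eq_iff)
    ultimately show ?thesis using ij(2) by (simp add: insert_commute mult_2)
  qed
  hence "(\<Sum>e\<in>edges G. \<Sum>a\<in>{a \<in> parcs G. ?p a = e}. f (?p a)) = 2 * (\<Sum>e\<in>edges G. f e)"
    by (simp add: sum_distrib_left)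
  moreover have "(\<Sum>a\<in>parcs G. f (?p a)) =
      (\<Sum>e\<in>edges G. \<Sum>a\<in>{a \<in> parcs G. ?p a = e}. f (?p a))"
    unfolding edges by (rule sum.image_gen[OF pair_finite_arcs])
  ultimately show ?thesis by (simp add: case_prod_unfold)
qed

lemma card_parcs_eq_twice_card_edges:
  assumes "pair_graph G"
  shows "card (parcs G) = 2 * card (edges G)"
  using sum_parcs_eq_twice_sum_edges[OF assms, of "\<lambda>_. 1::nat"] by simp

section \<open>The inequalities for graphs\<close>

text \<open>At the vector of square roots of the degrees, the form is twice the left-hand sum and
  the squared norm is the degree sum, twice the number of edges; the factors 2 cancel.\<close>

lemma sum_sqrt_degrees_le:
  assumes graph: "pair_graph G" and vs: "distinct vs" "set vs = pverts G"
  shows "(\<Sum>e\<in>edges G. sqrt (\<Prod>i\<in>e. real (vertex_degree G i))) \<le>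
    real (card (edges G)) * largest_eigenvalue (adjacency_matrix G vs)"
proof -
  interpret pair_graph G by fact
  let ?A = "adjacency_matrix G vs" and ?n = "length vs"
  let ?d = "\<lambda>i. real (vertex_degree G i)" and ?V = "pverts G"
  have reindex: "(\<Sum>k<?n. h (vs ! k)) = (\<Sum>i\<in>?V. h i)" for h :: "'a \<Rightarrow> real"
    using sum.reindex_bij_betw[OF bij_betw_nth[OF vs(1) refl vs(2)[symmetric]]] .
  have ray: "(\<Sum>k<?n. \<Sum>l<?n. ?A $$ (k, l) * sqrt (?d (vs ! k)) * sqrt (?d (vs ! l))) \<le>
      largest_eigenvalue ?A * (\<Sum>k<?n. (sqrt (?d (vs ! k)))\<^sup>2)"
    by (rule rayleigh_le_largest_eigenvalue)
      (auto simp: adjacency_matrix_def dest: parcs_swap[OF graph])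
  have "(\<Sum>k<?n. \<Sum>l<?n. ?A $$ (k, l) * sqrt (?d (vs ! k)) * sqrt (?d (vs ! l))) =
      (\<Sum>k<?n. \<Sum>l<?n. of_bool ((vs ! k, vs ! l) \<in> parcs G) * sqrt (?d (vs ! k) * ?d (vs ! l)))"
    by (intro sum.cong refl) (simp add: adjacency_matrix_def real_sqrt_mult)
  also have "\<dots> = (\<Sum>k<?n. \<Sum>j\<in>?V. of_bool ((vs ! k, j) \<in> parcs G) * sqrt (?d (vs ! k) * ?d j))"
    by (rule sum.cong[OF refl], rule sym, rule reindex[symmetric])
  also have "\<dots> = (\<Sum>i\<in>?V. \<Sum>j\<in>?V. of_bool ((i, j) \<in> parcs G) * sqrt (?d i * ?d j))"
    by (rule reindex)
  also have "\<dots> = (\<Sum>(i, j)\<in>?V \<times> ?V. of_bool ((i, j) \<in> parcs G) * sqrt (?d i * ?d j))"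
    by (rule sum.cartesian_product)
  also have "\<dots> = (\<Sum>(i, j)\<in>parcs G. sqrt (?d i * ?d j))"
    using pair_finite_verts arc_fst_in_verts arc_snd_in_verts
    by (intro sum.mono_neutral_cong_right) force+
  \<comment> \<open>The summand is rewritten to depend on the unordered pair only; the product has
    two factors because \<open>i\<close> and \<open>j\<close> differ.\<close>
  also have "\<dots> = (\<Sum>(i, j)\<in>parcs G. sqrt (\<Prod>i\<in>{i, j}. ?d i))"
    by (intro sum.cong refl) (auto dest: pair_no_loops)
  also have "\<dots> = 2 * (\<Sum>e\<in>edges G. sqrt (\<Prod>i\<in>e. ?d i))"
    by (rule sum_parcs_eq_twice_sum_edges[OF graph])
  finally have form: "(\<Sum>k<?n. \<Sum>l<?n. ?A $$ (k, l) * sqrt (?d (vs ! k)) * sqrt (?d (vs ! l))) =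
    2 * (\<Sum>e\<in>edges G. sqrt (\<Prod>i\<in>e. ?d i))" .
  have "(\<Sum>k<?n. (sqrt (?d (vs ! k)))\<^sup>2) = real (\<Sum>i\<in>?V. vertex_degree G i)"
    using reindex[of ?d] by simp
  also have "\<dots> = 2 * real (card (edges G))"
    using sum_vertex_degree[OF pair_fin_digraph] card_parcs_eq_twice_card_edges[OF graph] by simp
  finally show ?thesis using ray form by (simp add: mult_ac)
qed

theorem mainTheorem7:
  fixes G :: "'a pair_pre_digraph" and vs :: "'a list"
    and n m :: nat and \<mu> \<beta> \<epsilon> :: real
  assumes graph: "pair_graph G"
    and vs: "distinct vs" "set vs = pverts G"
  defines "n \<equiv> card (pverts G)"
    and "m \<equiv> card (edges G)"
    and "\<mu> \<equiv> largest_eigenvalue (adjacency_matrix G vs)"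
    and "\<beta> \<equiv> beta_irregularity G vs"
    and "\<epsilon> \<equiv> epsilon_irregularity G"
  assumes m: "m \<ge> 1"
  shows "real m / \<mu> = real n / (2 * \<beta>) \<and>
         real n / (2 * \<beta>) \<le> real n / (2 * \<epsilon>) \<and>
         real n / (2 * \<epsilon>) \<le> randic_index G"
proof -
  interpret pair_graph G by fact
  define w where "w e = (\<Prod>i\<in>e. real (vertex_degree G i))" for e
  define S where "S = (\<Sum>e\<in>edges G. sqrt (w e))"
  have fin: "finite (edges G)" and ne: "edges G \<noteq> {}"
    using m by (auto simp: m_def intro: card_ge_0_finite)
  have w: "w e > 0" if "e \<in> edges G" for e
    unfolding w_def using that graph parcs_swap[OF graph]
    by (auto simp: edges_def intro!: prod_pos vertex_degree_pos[OF pair_fin_digraph])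
  have S: "S > 0"
    unfolding S_def using fin ne w by (intro sum_pos) auto
  \<comment> \<open>An edge has an endpoint, so \<open>n\<close> is positive and cancels in the two
    quotients below.\<close>
  obtain i j where ij: "(i, j) \<in> parcs G" using ne by (auto simp: edges_def)
  hence n: "n > 0"
    using pair_finite_verts arc_fst_in_verts[OF ij] by (auto simp: n_def card_gt_0_iff)
  have le: "S \<le> real m * \<mu>"
    using sum_sqrt_degrees_le[OF graph vs] by (simp add: S_def w_def m_def \<mu>_def)
  \<comment> \<open>Positivity of the largest eigenvalue falls out of the Rayleigh bound, since
    \<open>S\<close> is positive.\<close>
  have \<mu>: "\<mu> > 0" using S le m by (smt (verit) mult_nonneg_nonpos of_nat_0_le_iff)
  have beta: "real n / (2 * \<beta>) = real m / \<mu>"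
    using n m by (simp add: \<beta>_def beta_irregularity_def n_def[symmetric] m_def[symmetric]
        \<mu>_def[symmetric] field_simps)
  have eps: "real n / (2 * \<epsilon>) = (real m)\<^sup>2 / S"
    using n m S by (simp add: \<epsilon>_def epsilon_irregularity_def n_def[symmetric] m_def[symmetric]
        w_def[symmetric] S_def[symmetric] field_simps)
  have "real m * S \<le> real m * (real m * \<mu>)" using le by (intro mult_left_mono) auto
  hence "real m / \<mu> \<le> (real m)\<^sup>2 / S"
    using \<mu> S by (simp add: field_simps power2_eq_square)
  moreover have "(real m)\<^sup>2 / S \<le> randic_index G"
  proof -
    \<comment> \<open>Each summand is 1, split into two factors whose squares sum to
      \<open>S\<close> and to the Randic index.\<close>
    have "real m = (\<Sum>e\<in>edges G. sqrt (sqrt (w e)) * sqrt (1 / sqrt (w e)))"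
      using w by (simp add: m_def real_sqrt_mult[symmetric] less_imp_neq[symmetric])
    hence "(real m)\<^sup>2 \<le> (\<Sum>e\<in>edges G. (sqrt (sqrt (w e)))\<^sup>2) *
        (\<Sum>e\<in>edges G. (sqrt (1 / sqrt (w e)))\<^sup>2)"
      using Cauchy_Schwarz_ineq_sum by metis
    also have "\<dots> = S * randic_index G"
      unfolding S_def randic_index_def w_def[symmetric]
      by (intro arg_cong2[of _ _ _ _ "(*)"] sum.cong refl) (auto dest: w)
    finally show ?thesis using S by (simp add: field_simps)
  qed
  ultimately show ?thesis using beta eps by simp
qed

end
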